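(* Let $q$ be a prime power, $n \geq 1$, $\lambda > 0$, $\eta > 0$, and let $\Lambda > 0$ be an integer with $\eta q > \Lambda$. Let $S \subseteq \mathbb{F}_q^n$ with $|S| = \lambda q^n$. Let $K \subseteq \mathbb{F}_q^n$ be such that for each $\mathbf{x} \in S$ there exists a curve $C_{\mathbf{x}}$ of degree at most $\Lambda$ that passes through $\mathbf{x}$ and intersects $K$ in at least $\eta q$ points, i.e. $|\{t \in \mathbb{F}_q : C_{\mathbf{x}}(t) \in K\}| \geq \eta q$. Then $$|K| \geq \left(\frac{\lambda q}{\Lambda\left(\frac{\lambda q - 1}{\eta q}\right) + 1}\right)^n.$$ In particular, if $\lambda \geq \eta$, then $|K| \geq \left(\frac{\eta q}{\Lambda + 1}\right)^n$.
   Context: A curve of degree $\Lambda$ in $\mathbb{F}_q^n$ is a tuple $C(X) = (C_1(X),\ldots,C_n(X)) \in \mathbb{F}_q[X]^n$ with $\max_i \deg C_i = \Lambda$; it defines a map $\mathbb{F}_q \to \mathbb{F}_q^n$, $t \mapsto C(t)$. A curve $C$ passes through $\mathbf{x}$ if $C(t) = \mathbf{x}$ for some $t \in \mathbb{F}_q$. *)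

theory Defs
  imports "HOL-Analysis.Finite_Cartesian_Product" "HOL-Computational_Algebra.Polynomial"
begin

type_synonym ('a, 'n) curve = "'a poly ^ 'n"

definition curve_degree :: "('a::zero, 'n::finite) curve \<Rightarrow> nat" where
  "curve_degree C = Max (range (\<lambda>i. degree (C $ i)))"

definition curve_eval :: "('a::comm_semiring_0, 'n::finite) curve \<Rightarrow> 'a \<Rightarrow> 'a ^ 'n" where
  "curve_eval C t = (\<chi> i. poly (C $ i) t)"

definition passes_through :: "('a::comm_semiring_0, 'n::finite) curve \<Rightarrow> 'a ^ 'n \<Rightarrow> bool" where
  "passes_through C x \<longleftrightarrow> (\<exists>t. curve_eval C t = x)"

end

theory Submission
  imports Defs "HOL-Library.FuncSet" "HOL-Real_Asymp.Real_Asymp"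
begin

text \<open>The proof is the method of multiplicities. If \<open>K\<close> is small, counting coefficients yields a nonzero
  polynomial $P$ of degree at most $d$ vanishing to order $m$ on \<open>K\<close>. Along a curve $C$ of degree
  at most $\Lambda$, a Hasse derivative of $P$ of weight $w$ becomes a univariate polynomial of degree at
  most $\Lambda(d - w)$ with zeros of order $m - w$ at all parameters mapped into \<open>K\<close>. For $m$ slightly
  above $\Lambda(d - L)/(\eta q) + L$ it is identically zero for every $w < L$, so $P$ vanishes to order
  $L$ on \<open>S\<close>. If $d < \lambda q L$, this contradicts the Schwartz--Zippel lemma with multiplicities,
  by which the orders of vanishing of $P$ add up to at most $d q^{n-1}$. Hence $|K|$ is at least about
  $(d/m)^n$, and the bound follows as $L$ tends to infinity.\<close>

text \<open>A polynomial $P$ in the variables indexed by \<open>'n\<close> is given by a finite set \<open>E\<close> of exponent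
  vectors and its coefficients \<open>c\<close>, of which only the values on \<open>E\<close> matter. The \<open>i\<close>-th Taylor
  coefficient at \<open>a\<close> is the coefficient of $Z^i$ in $P(a + Z)$, that is, the \<open>i\<close>-th Hasse
  derivative of $P$ at \<open>a\<close>; $P$ vanishes at \<open>a\<close> to order \<open>m\<close> if it is \<open>0\<close> whenever
  \<open>i\<close> has weight below \<open>m\<close>.\<close>

definition taylor_coeff ::
  "('n::finite \<Rightarrow> nat) set \<Rightarrow> (('n \<Rightarrow> nat) \<Rightarrow> 'r::comm_ring_1) \<Rightarrow> ('n \<Rightarrow> 'r) \<Rightarrow> ('n \<Rightarrow> nat) \<Rightarrow> 'r"
  where "taylor_coeff E c a i =
    (\<Sum>\<alpha>\<in>E. c \<alpha> * (\<Prod>j\<in>UNIV. of_nat (\<alpha> j choose i j) * a j ^ (\<alpha> j - i j)))"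

abbreviation (input) weight :: "('n::finite \<Rightarrow> nat) \<Rightarrow> nat"
  where "weight i \<equiv> sum i UNIV"

section \<open>Taylor expansion and vanishing orders under substitution of univariate
  polynomials\<close>

text \<open>This is the expansion in \<open>b\<close> of a Hasse derivative of a one-variable
  monomial. Summing up to a uniform bound \<open>D\<close>, with vanishing terms beyond
  \<open>m - i\<close>, gives all exponents the same index set, so that a product over the variables
  can be expanded at once.\<close>

lemma binomial_shift:
  fixes a b :: "'r::comm_ring_1"
  assumes "m \<le> D"
  shows "of_nat (m choose i) * (a + b) ^ (m - i) =
    (\<Sum>k\<le>D. of_nat (m choose (i + k)) * a ^ (m - (i + k)) * (of_nat (i + k choose i) * b ^ k))"
proof (cases "i \<le> m")
  case True
  have "(\<Sum>k\<le>D. of_nat (m choose (i + k)) * a ^ (m - (i + k)) * (of_nat (i + k choose i) * b ^ k)) =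
    (\<Sum>k\<le>m - i. of_nat (m choose (i + k)) * a ^ (m - (i + k)) * (of_nat (i + k choose i) * b ^ k))"
    using assms True
    by (intro sum.mono_neutral_right ballI) (auto simp: binomial_eq_0 not_le)
  also have "\<dots> = (\<Sum>k\<le>m - i. of_nat (m choose i) * (of_nat (m - i choose k) * b ^ k * a ^ (m - i - k)))"
  proof (rule sum.cong [OF refl])
    fix k assume "k \<in> {..m - i}"
    then have "(m choose (i + k)) * (i + k choose i) = (m choose i) * (m - i choose k)"
      using choose_mult [of i "i + k" m] True by auto
    then have "(of_nat (m choose (i + k)) * of_nat (i + k choose i) :: 'r) =
        of_nat (m choose i) * of_nat (m - i choose k)"
      by (metis of_nat_mult)
    then have "(of_nat (m choose (i + k)) * of_nat (i + k choose i)) * (a ^ (m - i - k) * b ^ k) =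
        (of_nat (m choose i) * of_nat (m - i choose k)) * (a ^ (m - i - k) * b ^ k)"
      by (rule arg_cong)
    then show "of_nat (m choose (i + k)) * a ^ (m - (i + k)) * (of_nat (i + k choose i) * b ^ k) =
        of_nat (m choose i) * (of_nat (m - i choose k) * b ^ k * a ^ (m - i - k))"
      unfolding diff_diff_left by (simp only: mult_ac)
  qed
  also have "\<dots> = of_nat (m choose i) * (a + b) ^ (m - i)"
    by (simp add: binomial_ring [of b a] add.commute [of a b] sum_distrib_left)
  finally show ?thesis by simp
qed (simp add: binomial_eq_0)

lemma taylor_coeff_add:
  fixes a b :: "'n::finite \<Rightarrow> 'r::comm_ring_1"
  assumes "\<And>\<alpha> j. \<alpha> \<in> E \<Longrightarrow> \<alpha> j \<le> D"
  shows "taylor_coeff E c (\<lambda>j. a j + b j) i =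
    (\<Sum>k\<in>UNIV \<rightarrow>\<^sub>E {..D}. taylor_coeff E c a (\<lambda>j. i j + k j) *
      (\<Prod>j\<in>UNIV. of_nat (i j + k j choose i j) * b j ^ k j))"
proof -
  have "taylor_coeff E c (\<lambda>j. a j + b j) i = (\<Sum>\<alpha>\<in>E. c \<alpha> *
    (\<Prod>j\<in>UNIV. \<Sum>k\<le>D. of_nat (\<alpha> j choose (i j + k)) * a j ^ (\<alpha> j - (i j + k)) *
       (of_nat (i j + k choose i j) * b j ^ k)))"
    unfolding taylor_coeff_def using assms
    by (intro sum.cong prod.cong refl arg_cong2 [where f = "(*)"] binomial_shift) auto
  also have "\<dots> = (\<Sum>\<alpha>\<in>E. \<Sum>k\<in>UNIV \<rightarrow>\<^sub>E {..D}. c \<alpha> *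
    (\<Prod>j\<in>UNIV. of_nat (\<alpha> j choose (i j + k j)) * a j ^ (\<alpha> j - (i j + k j)) *
       (of_nat (i j + k j choose i j) * b j ^ k j)))"
    by (subst prod_sum_PiE) (simp_all add: sum_distrib_left)
  also have "\<dots> = (\<Sum>k\<in>UNIV \<rightarrow>\<^sub>E {..D}. \<Sum>\<alpha>\<in>E. c \<alpha> *
    (\<Prod>j\<in>UNIV. of_nat (\<alpha> j choose (i j + k j)) * a j ^ (\<alpha> j - (i j + k j)) *
       (of_nat (i j + k j choose i j) * b j ^ k j)))"
    by (rule sum.swap)
  also have "\<dots> = (\<Sum>k\<in>UNIV \<rightarrow>\<^sub>E {..D}. taylor_coeff E c a (\<lambda>j. i j + k j) *
      (\<Prod>j\<in>UNIV. of_nat (i j + k j choose i j) * b j ^ k j))"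
    by (simp add: taylor_coeff_def sum_distrib_right prod.distrib mult.assoc)
  finally show ?thesis .
qed

text \<open>A curve is a point over the ring \<open>'a poly\<close>, while vanishing is assumed over
  \<open>'a\<close>; constant points link the two.\<close>

lemma taylor_coeff_const_poly:
  "taylor_coeff E (\<lambda>\<alpha>. [:c \<alpha>:]) (\<lambda>j. [:a j:]) i = [:taylor_coeff E c a i:]"
proof -
  have "taylor_coeff E (\<lambda>\<alpha>. [:c \<alpha>:]) (\<lambda>j. [:a j:]) i =
    (\<Sum>\<alpha>\<in>E. [:c \<alpha>:] * (\<Prod>j\<in>UNIV. [:of_nat (\<alpha> j choose i j) * a j ^ (\<alpha> j - i j):]))"
    unfolding taylor_coeff_def by (simp add: of_nat_poly poly_const_pow mult_ac)
  also have "\<dots> = [:taylor_coeff E c a i:]"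
    unfolding taylor_coeff_def by (induction E rule: infinite_finite_induct) (simp_all add: prod_to_poly)
  finally show ?thesis .
qed

lemma poly_taylor_coeff:
  "poly (taylor_coeff E (\<lambda>\<alpha>. [:c \<alpha>:]) A i) s = taylor_coeff E c (\<lambda>j. poly (A j) s) i"
  unfolding taylor_coeff_def by (simp add: poly_sum poly_prod)

text \<open>Expanding $P(A(X) + Z)$ around $A(t)$, every term lies in the ideal $(X - t, Z)^m$, because $X - t$
  divides $A(X) - A(t)$. No iterated Hasse derivatives are needed.\<close>

lemma taylor_coeff_multiplicity:
  fixes c :: "('n::finite \<Rightarrow> nat) \<Rightarrow> 'a::comm_ring_1" and A :: "'n \<Rightarrow> 'a poly"
  assumes "finite E"
    and van: "\<And>k. weight k < m \<Longrightarrow> taylor_coeff E c (\<lambda>j. poly (A j) t) k = 0"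
  shows "[:- t, 1:] ^ (m - weight i) dvd taylor_coeff E (\<lambda>\<alpha>. [:c \<alpha>:]) A i"
proof -
  define D where "D = Max (insert 0 (\<Union>\<alpha>\<in>E. range \<alpha>))"
  have D: "\<alpha> j \<le> D" if "\<alpha> \<in> E" for \<alpha> j
    unfolding D_def using that assms(1) by (intro Max_ge) auto
  define a where "a = (\<lambda>j. [:poly (A j) t:])"
  define b where "b = (\<lambda>j. A j - a j)"
  have b_dvd: "[:- t, 1:] dvd b j" for j
    by (simp add: b_def a_def flip: poly_eq_0_iff_dvd)
  have "[:- t, 1:] ^ (m - weight i) dvd taylor_coeff E (\<lambda>\<alpha>. [:c \<alpha>:]) (\<lambda>j. a j + b j) i"
  proof (subst taylor_coeff_add [where D = D], erule D, rule dvd_sum)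
    fix k
    show "[:- t, 1:] ^ (m - weight i) dvd
      taylor_coeff E (\<lambda>\<alpha>. [:c \<alpha>:]) a (\<lambda>j. i j + k j) *
      (\<Prod>j\<in>UNIV. of_nat (i j + k j choose i j) * b j ^ k j)"
    proof (cases "weight i + weight k < m")
      case True
      then show ?thesis
        by (simp add: a_def taylor_coeff_const_poly van sum.distrib)
    next
      case False
      have "[:- t, 1:] ^ (m - weight i) dvd [:- t, 1:] ^ weight k"
        using False by (intro le_imp_power_dvd) auto
      also have "\<dots> = (\<Prod>j\<in>UNIV. [:- t, 1:] ^ k j)"
        by (simp add: power_sum)
      also have "\<dots> dvd (\<Prod>j\<in>UNIV. of_nat (i j + k j choose i j) * b j ^ k j)"
        by (intro prod_dvd_prod dvd_mult dvd_power_same b_dvd)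
      finally show ?thesis by (rule dvd_mult)
    qed
  qed
  then show ?thesis by (simp add: b_def)
qed

section \<open>Root counting, nonvanishing and degree bounds\<close>

lemma sum_multiplicities_le_degree:
  fixes p :: "'a::idom poly"
  assumes "p \<noteq> 0" "finite T" "\<And>t. t \<in> T \<Longrightarrow> [:- t, 1:] ^ e t dvd p"
  shows "(\<Sum>t\<in>T. e t) \<le> degree p"
proof -
  have e: "e t \<le> order t p" if "t \<in> T" for t
    using assms(3) [OF that] assms(1) by (simp add: order_divides)
  then have "(\<Sum>t\<in>T. e t) \<le> (\<Sum>t\<in>T. order t p)" by (rule sum_mono)
  also have "\<dots> = (\<Sum>t\<in>{t\<in>T. poly p t = 0}. order t p)"
    using assms(1,2) by (intro sum.mono_neutral_right) (auto simp: order_root)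
  also have "\<dots> \<le> (\<Sum>t | poly p t = 0. order t p)"
    using assms(1) by (intro sum_mono2) (auto simp: poly_roots_finite)
  also have "\<dots> \<le> degree p" using assms(1) by (rule sum_order_le_degree)
  finally show ?thesis .
qed

text \<open>Each product contains a binomial coefficient that is \<open>0\<close>. For the same
  reason the truncated exponents \<open>\<alpha> j - i j\<close> do no harm.\<close>

lemma taylor_coeff_eq_0:
  assumes "\<And>\<alpha>. \<alpha> \<in> E \<Longrightarrow> \<exists>j. \<alpha> j < i j"
  shows "taylor_coeff E c a i = 0"
  unfolding taylor_coeff_def
proof (intro sum.neutral ballI)
  fix \<alpha> assume "\<alpha> \<in> E"
  then obtain j where "\<alpha> j < i j" using assms by blast
  then have "(\<Prod>j\<in>UNIV. of_nat (\<alpha> j choose i j) * a j ^ (\<alpha> j - i j)) = 0"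
    by (intro prod_zero) (auto simp: binomial_eq_0 intro!: exI [of _ j])
  then show "c \<alpha> * (\<Prod>j\<in>UNIV. of_nat (\<alpha> j choose i j) * a j ^ (\<alpha> j - i j)) = 0" by simp
qed

lemma weight_le_imp_exists_less:
  fixes \<alpha> i :: "'n::finite \<Rightarrow> nat"
  assumes "weight \<alpha> \<le> weight i" "\<alpha> \<noteq> i"
  shows "\<exists>j. \<alpha> j < i j"
proof (rule ccontr)
  assume "\<not> ?thesis"
  then have le: "i j \<le> \<alpha> j" for j by (simp add: not_less)
  obtain j where "\<alpha> j \<noteq> i j" using assms(2) by blast
  with le have "i j < \<alpha> j" by (metis le_neq_implies_less)
  then have "weight i < weight \<alpha>" using le by (intro sum_strict_mono_ex1) auto
  with assms(1) show False by simp
qed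

text \<open>Take for \<open>i\<close> an exponent vector of maximal weight in \<open>E\<close>.
  Every other member of \<open>E\<close> is below \<open>i\<close> in some coordinate, so only the
  constant \<open>c i\<close> survives, at every point \<open>a\<close> and in every
  characteristic.\<close>

lemma taylor_coeff_nonzero:
  fixes c :: "('n::finite \<Rightarrow> nat) \<Rightarrow> 'a::comm_ring_1"
  assumes "finite E" "E \<noteq> {}" "\<And>\<alpha>. \<alpha> \<in> E \<Longrightarrow> c \<alpha> \<noteq> 0"
  shows "\<exists>i. taylor_coeff E c a i \<noteq> 0"
proof -
  obtain i where i: "i \<in> E" "\<And>\<alpha>. \<alpha> \<in> E \<Longrightarrow> weight \<alpha> \<le> weight i"
    using Max_in [of "weight ` E"] Max_ge [of "weight ` E"] assms(1,2)
    by (metis (no_types, lifting) finite_imageI image_eqI image_iff image_is_empty)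
  have "taylor_coeff E c a i = taylor_coeff (insert i (E - {i})) c a i"
    using i by (simp add: insert_absorb)
  also have "\<dots> = c i + taylor_coeff (E - {i}) c a i"
    using assms(1) unfolding taylor_coeff_def by (subst sum.insert) auto
  also have "taylor_coeff (E - {i}) c a i = 0"
    using i(2) by (intro taylor_coeff_eq_0 weight_le_imp_exists_less) auto
  finally show ?thesis using assms(3) i(1) by (metis add.right_neutral)
qed

text \<open>Differentiation lowers each surviving exponent \<open>\<alpha> j\<close> by
  \<open>i j\<close>, hence the total degree by \<open>weight i\<close>; substitution then
  multiplies it by at most \<open>N\<close>.\<close>

lemma degree_taylor_coeff_le:
  fixes A :: "'n::finite \<Rightarrow> 'a::comm_ring_1 poly"
  assumes "finite E" "\<And>\<alpha>. \<alpha> \<in> E \<Longrightarrow> weight \<alpha> \<le> d" "\<And>j. degree (A j) \<le> N"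
  shows "degree (taylor_coeff E (\<lambda>\<alpha>. [:c \<alpha>:]) A i) \<le> N * (d - weight i)"
  unfolding taylor_coeff_def
proof (rule degree_sum_le [OF assms(1)])
  fix \<alpha> assume \<alpha>: "\<alpha> \<in> E"
  show "degree ([:c \<alpha>:] * (\<Prod>j\<in>UNIV. of_nat (\<alpha> j choose i j) * A j ^ (\<alpha> j - i j)))
    \<le> N * (d - weight i)"
  proof (cases "\<exists>j. \<alpha> j < i j")
    case True
    then have "taylor_coeff {\<alpha>} (\<lambda>\<alpha>. [:c \<alpha>:]) A i = 0" by (intro taylor_coeff_eq_0) auto
    then show ?thesis by (simp add: taylor_coeff_def)
  next
    case False
    then have ge: "i j \<le> \<alpha> j" for j by (simp add: not_less)
    have "degree ([:c \<alpha>:] * (\<Prod>j\<in>UNIV. of_nat (\<alpha> j choose i j) * A j ^ (\<alpha> j - i j)))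
      \<le> degree (\<Prod>j\<in>UNIV. of_nat (\<alpha> j choose i j) * A j ^ (\<alpha> j - i j))"
      by (simp add: degree_smult_le)
    also have "\<dots> \<le> (\<Sum>j\<in>UNIV. degree (of_nat (\<alpha> j choose i j) * A j ^ (\<alpha> j - i j)))"
      using degree_prod_sum_le [of UNIV "\<lambda>j. of_nat (\<alpha> j choose i j) * A j ^ (\<alpha> j - i j)"]
      by (simp add: o_def)
    also have "\<dots> \<le> (\<Sum>j\<in>UNIV. N * (\<alpha> j - i j))"
    proof (rule sum_mono)
      fix j
      have "degree (of_nat (\<alpha> j choose i j) * A j ^ (\<alpha> j - i j)) \<le> degree (A j ^ (\<alpha> j - i j))"
        using degree_mult_le [of "of_nat (\<alpha> j choose i j)" "A j ^ (\<alpha> j - i j)"] by simp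
      also have "\<dots> \<le> degree (A j) * (\<alpha> j - i j)" by (rule degree_power_le)
      also have "\<dots> \<le> N * (\<alpha> j - i j)" using assms(3) by (rule mult_le_mono1)
      finally show "degree (of_nat (\<alpha> j choose i j) * A j ^ (\<alpha> j - i j)) \<le> N * (\<alpha> j - i j)" .
    qed
    also have "\<dots> = N * (weight \<alpha> - weight i)"
      using ge by (simp add: sum_distrib_left [symmetric] sum_subtractf_nat)
    also have "\<dots> \<le> N * (d - weight i)" using assms(2) [OF \<alpha>] by (intro mult_le_mono2 diff_le_mono)
    finally show ?thesis .
  qed
qed

section \<open>Restriction to coordinate lines and the Schwartz--Zippel lemma with
  multiplicities\<close>

text \<open>The substituted point runs along the line through \<open>a\<close> in direction
  \<open>v\<close>. As \<open>i\<close> takes no derivative in \<open>v\<close>, each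
  \<open>\<alpha>\<close> contributes a single monomial of degree \<open>\<alpha> v\<close>, so
  degree and coefficients can be read off.\<close>

lemma taylor_coeff_line:
  fixes c :: "('n::finite \<Rightarrow> nat) \<Rightarrow> 'a::comm_ring_1"
  assumes "i v = 0"
  shows "taylor_coeff E (\<lambda>\<alpha>. [:c \<alpha>:]) ((\<lambda>j. [:a j:])(v := [:0, 1:])) i =
    (\<Sum>\<alpha>\<in>E. monom (c \<alpha> * (\<Prod>j\<in>-{v}. of_nat (\<alpha> j choose i j) * a j ^ (\<alpha> j - i j))) (\<alpha> v))"
  unfolding taylor_coeff_def
proof (rule sum.cong [OF refl])
  fix \<alpha> assume "\<alpha> \<in> E"
  let ?A = "(\<lambda>j. [:a j:])(v := [:0, 1:])"
  have "(\<Prod>j\<in>UNIV. of_nat (\<alpha> j choose i j) * ?A j ^ (\<alpha> j - i j)) =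
    [:0, 1:] ^ \<alpha> v * (\<Prod>j\<in>-{v}. of_nat (\<alpha> j choose i j) * ?A j ^ (\<alpha> j - i j))"
    using assms by (subst prod.remove [of _ v]) (simp_all add: Compl_eq_Diff_UNIV)
  also have "(\<Prod>j\<in>-{v}. of_nat (\<alpha> j choose i j) * ?A j ^ (\<alpha> j - i j)) =
    (\<Prod>j\<in>-{v}. [:of_nat (\<alpha> j choose i j) * a j ^ (\<alpha> j - i j):])"
    by (intro prod.cong refl) (auto simp: of_nat_poly poly_const_pow mult_ac)
  also have "\<dots> = [:\<Prod>j\<in>-{v}. of_nat (\<alpha> j choose i j) * a j ^ (\<alpha> j - i j):]"
    by (rule prod_to_poly)
  finally show "[:c \<alpha>:] * (\<Prod>j\<in>UNIV. of_nat (\<alpha> j choose i j) * ?A j ^ (\<alpha> j - i j)) =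
    monom (c \<alpha> * (\<Prod>j\<in>-{v}. of_nat (\<alpha> j choose i j) * a j ^ (\<alpha> j - i j))) (\<alpha> v)"
    by (simp add: monom_altdef mult_ac)
qed

text \<open>The left side belongs to the coefficient of the \<open>t\<close>-th power of the
  variable \<open>v\<close>, itself a polynomial in the other variables. Derivatives in those
  variables act coefficientwise.\<close>

lemma taylor_coeff_slice:
  fixes c :: "('n::finite \<Rightarrow> nat) \<Rightarrow> 'a::comm_ring_1"
  assumes "finite E" "i v = 0"
  shows "taylor_coeff ((\<lambda>\<alpha>. \<alpha>(v := 0)) ` {\<alpha>\<in>E. \<alpha> v = t}) (\<lambda>\<beta>. c (\<beta>(v := t))) a i =
    coeff (taylor_coeff E (\<lambda>\<alpha>. [:c \<alpha>:]) ((\<lambda>j. [:a j:])(v := [:0, 1:])) i) t"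
proof -
  have inj: "inj_on (\<lambda>\<alpha>. \<alpha>(v := 0)) {\<alpha>\<in>E. \<alpha> v = t}"
    by (rule inj_on_inverseI [where g = "\<lambda>\<beta>. \<beta>(v := t)"]) auto
  have "taylor_coeff ((\<lambda>\<alpha>. \<alpha>(v := 0)) ` {\<alpha>\<in>E. \<alpha> v = t}) (\<lambda>\<beta>. c (\<beta>(v := t))) a i =
    (\<Sum>\<alpha>\<in>{\<alpha>\<in>E. \<alpha> v = t}. c \<alpha> * (\<Prod>j\<in>-{v}. of_nat (\<alpha> j choose i j) * a j ^ (\<alpha> j - i j)))"
    unfolding taylor_coeff_def sum.reindex [OF inj] o_def
  proof (rule sum.cong [OF refl])
    fix \<alpha> assume \<alpha>: "\<alpha> \<in> {\<alpha>\<in>E. \<alpha> v = t}"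
    have "(\<Prod>j\<in>UNIV. of_nat ((\<alpha>(v := 0)) j choose i j) * a j ^ ((\<alpha>(v := 0)) j - i j)) =
      (\<Prod>j\<in>-{v}. of_nat ((\<alpha>(v := 0)) j choose i j) * a j ^ ((\<alpha>(v := 0)) j - i j))"
      using assms(2) by (subst prod.remove [of _ v]) (simp_all add: Compl_eq_Diff_UNIV)
    also have "\<dots> = (\<Prod>j\<in>-{v}. of_nat (\<alpha> j choose i j) * a j ^ (\<alpha> j - i j))"
      by (intro prod.cong) auto
    moreover have "\<alpha>(v := 0, v := t) = \<alpha>" using \<alpha> by auto
    ultimately show "c (\<alpha>(v := 0, v := t)) *
        (\<Prod>j\<in>UNIV. of_nat ((\<alpha>(v := 0)) j choose i j) * a j ^ ((\<alpha>(v := 0)) j - i j)) =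
      c \<alpha> * (\<Prod>j\<in>-{v}. of_nat (\<alpha> j choose i j) * a j ^ (\<alpha> j - i j))"
      by (simp only:)
  qed
  also have "\<dots> = coeff (taylor_coeff E (\<lambda>\<alpha>. [:c \<alpha>:]) ((\<lambda>j. [:a j:])(v := [:0, 1:])) i) t"
    using assms(1) by (simp add: taylor_coeff_line [of i, OF assms(2)] coeff_sum sum.inter_filter)
  finally show ?thesis .
qed

text \<open>Double counting by the involution on pairs that sends \<open>(a, s)\<close> to
  \<open>(a(v := s), a v)\<close>.\<close>

lemma sum_fun_upd:
  fixes \<mu> :: "('n::finite \<Rightarrow> 'a::finite) \<Rightarrow> nat"
  shows "(\<Sum>a\<in>UNIV. \<Sum>s\<in>UNIV. \<mu> (a(v := s))) = CARD('a) * (\<Sum>a\<in>UNIV. \<mu> a)"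
proof -
  have "(\<Sum>a\<in>UNIV. \<Sum>s\<in>UNIV. \<mu> (a(v := s))) = (\<Sum>(a, s)\<in>(UNIV :: (('n \<Rightarrow> 'a) \<times> 'a) set). \<mu> (a(v := s)))"
    by (simp add: sum.cartesian_product)
  also have "\<dots> = (\<Sum>(a, s)\<in>(UNIV :: (('n \<Rightarrow> 'a) \<times> 'a) set). \<mu> a)"
    by (rule sum.reindex_bij_witness
        [of _ "\<lambda>(a, s). (a(v := s), a v)" "\<lambda>(a, s). (a(v := s), a v)"]) auto
  also have "\<dots> = (\<Sum>a\<in>UNIV. \<Sum>s\<in>(UNIV :: 'a set). \<mu> a)"
    by (simp only: sum.cartesian_product UNIV_Times_UNIV)
  finally show ?thesis by (simp add: sum_distrib_left)
qed

text \<open>The induction is on the set \<open>V\<close> of variables that occur, while the sum always ranges over all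
  points; the factor \<open>CARD('a)\<close> on the left avoids the exponent \<open>CARD('n) - 1\<close>.\<close>

lemma schwartz_zippel_multiplicity:
  fixes c :: "('n::finite \<Rightarrow> nat) \<Rightarrow> 'a::{field,finite}"
    and \<mu> :: "('n \<Rightarrow> 'a) \<Rightarrow> nat"
  assumes "finite E" "E \<noteq> {}" "\<And>\<alpha>. \<alpha> \<in> E \<Longrightarrow> c \<alpha> \<noteq> 0"
    and "\<And>\<alpha>. \<alpha> \<in> E \<Longrightarrow> weight \<alpha> \<le> d"
    and "\<And>a i. weight i < \<mu> a \<Longrightarrow> taylor_coeff E c a i = 0"
  shows "CARD('a) * (\<Sum>a\<in>UNIV. \<mu> a) \<le> d * CARD('a) ^ CARD('n)"
proof -
  have "CARD('a) * (\<Sum>a\<in>UNIV. \<mu> a) \<le> d * CARD('a) ^ CARD('n)"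
    if "finite V" "finite E" "E \<noteq> {}" "\<And>\<alpha>. \<alpha> \<in> E \<Longrightarrow> c \<alpha> \<noteq> 0"
      "\<And>\<alpha>. \<alpha> \<in> E \<Longrightarrow> weight \<alpha> \<le> d" "\<And>\<alpha> j. \<alpha> \<in> E \<Longrightarrow> j \<notin> V \<Longrightarrow> \<alpha> j = 0"
      "\<And>a i. weight i < \<mu> a \<Longrightarrow> taylor_coeff E c a i = 0"
    for V :: "'n set" and E and c :: "('n \<Rightarrow> nat) \<Rightarrow> 'a" and \<mu> d
    using that
  proof (induction V arbitrary: E c \<mu> d rule: finite_induct)
    case empty
    have "\<alpha> = (\<lambda>_. 0)" if "\<alpha> \<in> E" for \<alpha>
      using empty.prems(5) [OF that] by auto
    with empty.prems(2) have "E = {\<lambda>_. 0}" by blast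
    have "\<mu> a = 0" for a
    proof (rule ccontr)
      assume "\<mu> a \<noteq> 0"
      then have "taylor_coeff E c a (\<lambda>_. 0) = 0" by (intro empty.prems) simp
      with \<open>E = {\<lambda>_. 0}\<close> have "c (\<lambda>_. 0) = 0" by (simp add: taylor_coeff_def)
      with empty.prems(3) \<open>E = {\<lambda>_. 0}\<close> show False by simp
    qed
    then show ?case by simp
  next
    case (insert v V)
    define t where "t = Max ((\<lambda>\<alpha>. \<alpha> v) ` E)"
    have t_ge: "\<alpha> v \<le> t" if "\<alpha> \<in> E" for \<alpha>
      unfolding t_def using that insert.prems(1) by (intro Max_ge) auto
    have "t \<in> (\<lambda>\<alpha>. \<alpha> v) ` E"
      unfolding t_def using insert.prems(1,2) by (intro Max_in) auto
    then obtain \<alpha>\<^sub>0 where \<alpha>\<^sub>0: "\<alpha>\<^sub>0 \<in> E" "\<alpha>\<^sub>0 v = t" by auto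
    define E' where "E' = (\<lambda>\<alpha>. \<alpha>(v := 0)) ` {\<alpha>\<in>E. \<alpha> v = t}"
    define c' where "c' = (\<lambda>\<beta>. c (\<beta>(v := t)))"
    define P where "P = (\<lambda>a k. \<exists>i. weight i = k \<and> taylor_coeff E' c' a i \<noteq> 0)"
    \<comment> \<open>\<open>E'\<close>, \<open>c'\<close> is the leading coefficient with respect to variable \<open>v\<close>, and \<open>m a\<close> its order of
      vanishing at \<open>a\<close>.\<close>
    define m where "m = (\<lambda>a. LEAST k. P a k)"
    have E': "finite E'" "E' \<noteq> {}" using insert.prems(1) \<alpha>\<^sub>0 by (auto simp: E'_def)
    have c': "c' \<beta> \<noteq> 0" if "\<beta> \<in> E'" for \<beta>
      using that insert.prems(3) by (auto simp: E'_def c'_def)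
    have wt: "weight \<alpha> = weight (\<alpha>(v := 0)) + \<alpha> v" for \<alpha> :: "'n \<Rightarrow> nat"
    proof -
      have "sum (\<alpha>(v := 0)) (UNIV - {v}) = sum \<alpha> (UNIV - {v})" by (intro sum.cong) auto
      then show ?thesis
        using sum.remove [of UNIV v \<alpha>] sum.remove [of UNIV v "\<alpha>(v := 0)"]
        by (simp del: fun_upd_apply add: fun_upd_same)
    qed
    have P: "P a (m a)" for a
      unfolding m_def
    proof (rule LeastI_ex)
      show "\<exists>k. P a k" using taylor_coeff_nonzero [of E' c' a] E' c' by (auto simp: P_def)
    qed
    have wE': "weight \<beta> \<le> d - t" if "\<beta> \<in> E'" for \<beta>
    proof -
      from that obtain \<alpha> where "\<alpha> \<in> E" "\<alpha> v = t" "\<beta> = \<alpha>(v := 0)" by (auto simp: E'_def)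
      with insert.prems(4) [of \<alpha>] wt [of \<alpha>] show ?thesis by simp
    qed
    have vE': "\<beta> j = 0" if "\<beta> \<in> E'" "j \<notin> V" for \<beta> j
      using that insert.prems(5) by (auto simp: E'_def)
    have mE': "taylor_coeff E' c' a i = 0" if "weight i < m a" for a i
    proof -
      have "\<not> P a (weight i)" using that unfolding m_def by (rule not_less_Least)
      then show ?thesis unfolding P_def by blast
    qed
    \<comment> \<open>The leading coefficient is free of \<open>v\<close> and has degree at most
      \<open>d - t\<close>, so the induction hypothesis bounds the sum of its orders of
      vanishing.\<close>
    have IH: "CARD('a) * (\<Sum>a\<in>UNIV. m a) \<le> (d - t) * CARD('a) ^ CARD('n)"
      by (rule insert.IH [of E' c' "d - t" m]; fact E' c' wE' vE' mE')
    \<comment> \<open>A derivative of weight \<open>m a\<close> does not kill the leading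
      coefficient at \<open>a\<close>. On the line through \<open>a\<close> this derivative of the
      whole polynomial is a nonzero \<open>R\<close> of degree at most \<open>t\<close>, and its
      zeros have order at least \<open>\<mu> (a(v := s)) - m a\<close>.\<close>
    have line: "(\<Sum>s\<in>UNIV. \<mu> (a(v := s))) \<le> CARD('a) * m a + t" for a
    proof -
      obtain i where i: "weight i = m a" "taylor_coeff E' c' a i \<noteq> 0"
        using P [of a] by (auto simp: P_def)
      have iv: "i v = 0"
      proof (rule ccontr)
        assume "i v \<noteq> 0"
        then have "taylor_coeff E' c' a i = 0"
          by (intro taylor_coeff_eq_0 exI [of _ v]) (auto simp: E'_def)
        with i(2) show False ..
      qed
      define A where "A = (\<lambda>j. [:a j:])(v := [:0, 1:])"
      define R where "R = taylor_coeff E (\<lambda>\<alpha>. [:c \<alpha>:]) A i"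
      have "coeff R t \<noteq> 0"
        using i(2) taylor_coeff_slice [of E i v t c a, OF insert.prems(1) iv]
        by (simp add: R_def A_def E'_def c'_def)
      then have "R \<noteq> 0" by auto
      have "degree R \<le> t"
        unfolding R_def A_def taylor_coeff_line [of i, OF iv]
        using insert.prems(1) t_ge by (intro degree_sum_le) (auto intro: order_trans [OF degree_monom_le])
      have pA: "(\<lambda>j. poly (A j) s) = a(v := s)" for s by (auto simp: A_def)
      have "[:- s, 1:] ^ (\<mu> (a(v := s)) - weight i) dvd R" for s
        unfolding R_def using insert.prems(1,6)
        by (intro taylor_coeff_multiplicity) (simp_all add: pA)
      then have "(\<Sum>s\<in>UNIV. \<mu> (a(v := s)) - m a) \<le> degree R"
        using \<open>R \<noteq> 0\<close> i(1) by (intro sum_multiplicities_le_degree) auto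
      \<comment> \<open>Only an inequality, since subtraction is truncated where
        \<open>\<mu>\<close> is below \<open>m a\<close>.\<close>
      have "(\<Sum>s\<in>UNIV. \<mu> (a(v := s))) \<le> (\<Sum>s\<in>UNIV. m a + (\<mu> (a(v := s)) - m a))"
        by (rule sum_mono) simp
      also have "\<dots> = CARD('a) * m a + (\<Sum>s\<in>UNIV. \<mu> (a(v := s)) - m a)"
        by (simp add: sum.distrib)
      finally show ?thesis
        using \<open>degree R \<le> t\<close> \<open>(\<Sum>s\<in>UNIV. \<mu> (a(v := s)) - m a) \<le> degree R\<close> by simp
    qed
    have "t \<le> d" using insert.prems(4) [OF \<alpha>\<^sub>0(1)] wt [of \<alpha>\<^sub>0] \<alpha>\<^sub>0(2) by simp
    have "CARD('a) * (\<Sum>a\<in>UNIV. \<mu> a) = (\<Sum>a\<in>UNIV. \<Sum>s\<in>UNIV. \<mu> (a(v := s)))"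
      by (simp add: sum_fun_upd)
    also have "\<dots> \<le> (\<Sum>a\<in>UNIV. CARD('a) * m a + t)"
      by (intro sum_mono line)
    also have "\<dots> = CARD('a) * (\<Sum>a\<in>UNIV. m a) + t * CARD('a) ^ CARD('n)"
      by (simp add: sum.distrib sum_distrib_left card_fun mult.commute)
    also have "\<dots> \<le> (d - t) * CARD('a) ^ CARD('n) + t * CARD('a) ^ CARD('n)"
      using IH by simp
    also have "\<dots> = d * CARD('a) ^ CARD('n)"
      using \<open>t \<le> d\<close> by (simp flip: add_mult_distrib)
    finally show ?case .
  qed
  from this [of UNIV E c d \<mu>, OF _ assms(1-4) _ assms(5)] show ?thesis by simp
qed

section \<open>Counting exponent vectors and interpolation\<close>

text \<open>Induction on the set of variables that may occur: fixing the exponent of the new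
  variable splits the set into smaller instances, whose sizes add up by the hockey-stick
  identity.\<close>

lemma finite_weight_le: "finite {\<alpha> :: 'n::finite \<Rightarrow> nat. weight \<alpha> \<le> d}"
  and card_weight_le:
    "card {\<alpha> :: 'n \<Rightarrow> nat. weight \<alpha> \<le> d} = (d + CARD('n)) choose CARD('n)"
proof -
  have "finite {\<alpha> :: 'n \<Rightarrow> nat. (\<forall>j. j \<notin> V \<longrightarrow> \<alpha> j = 0) \<and> sum \<alpha> V \<le> d} \<and>
    card {\<alpha> :: 'n \<Rightarrow> nat. (\<forall>j. j \<notin> V \<longrightarrow> \<alpha> j = 0) \<and> sum \<alpha> V \<le> d} = (d + card V) choose card V"
    if "finite V" for V
    using that
  proof (induction V arbitrary: d rule: finite_induct)
    case empty
    have "{\<alpha> :: 'n \<Rightarrow> nat. (\<forall>j. j \<notin> {} \<longrightarrow> \<alpha> j = 0) \<and> sum \<alpha> {} \<le> d} = {\<lambda>_. 0}" by auto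
    then show ?case by simp
  next
    case (insert v V)
    define F where "F = (\<lambda>d. {\<alpha> :: 'n \<Rightarrow> nat. (\<forall>j. j \<notin> V \<longrightarrow> \<alpha> j = 0) \<and> sum \<alpha> V \<le> d})"
    have IH: "finite (F e)" "card (F e) = (e + card V) choose card V" for e
      using insert.IH [of e] by (simp_all add: F_def)
    have sum_upd: "sum (\<alpha>(v := k)) V = sum \<alpha> V" for \<alpha> :: "'n \<Rightarrow> nat" and k
      using insert.hyps(2) by (intro sum.cong) auto
    have F_upd: "\<alpha>(v := 0) \<in> F e \<longleftrightarrow> (\<forall>j. j \<notin> insert v V \<longrightarrow> \<alpha> j = 0) \<and> sum \<alpha> V \<le> e" for \<alpha> e
      unfolding F_def mem_Collect_eq sum_upd by auto
    \<comment> \<open>Here \<open>k\<close> is the weight left for \<open>V\<close> and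
      \<open>d - k\<close> the exponent of \<open>v\<close>; this indexing gives the rising sum of
      binomial coefficients directly.\<close>
    have eq: "{\<alpha> :: 'n \<Rightarrow> nat. (\<forall>j. j \<notin> insert v V \<longrightarrow> \<alpha> j = 0) \<and> sum \<alpha> (insert v V) \<le> d} =
      (\<Union>k\<le>d. (\<lambda>\<alpha>. \<alpha>(v := d - k)) ` F k)" (is "?L = ?R")
    proof (intro equalityI subsetI)
      fix \<alpha> assume "\<alpha> \<in> ?L"
      then have "\<alpha>(v := 0) \<in> F (d - \<alpha> v)" "\<alpha> v \<le> d"
        using insert.hyps by (auto simp: F_upd)
      then show "\<alpha> \<in> ?R"
        by (intro UN_I [of "d - \<alpha> v"] image_eqI [of _ _ "\<alpha>(v := 0)"]) auto
    next
      fix \<alpha> assume "\<alpha> \<in> ?R"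
      then obtain k \<beta> where "k \<le> d" "\<beta> \<in> F k" "\<alpha> = \<beta>(v := d - k)" by auto
      then have "sum \<alpha> V \<le> k" "\<alpha> v = d - k" "\<forall>j. j \<notin> insert v V \<longrightarrow> \<alpha> j = 0"
        using sum_upd [of \<beta> "d - k"] by (auto simp: F_def simp del: fun_upd_apply) (auto simp: F_def)
      with \<open>k \<le> d\<close> show "\<alpha> \<in> ?L" using insert.hyps by simp
    qed
    have "card ?R = (\<Sum>k\<le>d. card ((\<lambda>\<alpha>. \<alpha>(v := d - k)) ` F k))"
    proof (rule card_UN_disjoint)
      show "\<forall>k\<in>{..d}. \<forall>k'\<in>{..d}. k \<noteq> k' \<longrightarrow>
        (\<lambda>\<alpha>. \<alpha>(v := d - k)) ` F k \<inter> (\<lambda>\<alpha>. \<alpha>(v := d - k')) ` F k' = {}"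
      proof (intro ballI impI equals0I)
        fix k k' \<alpha> assume "k \<in> {..d}" "k' \<in> {..d}" "k \<noteq> k'"
          and "\<alpha> \<in> (\<lambda>\<alpha>. \<alpha>(v := d - k)) ` F k \<inter> (\<lambda>\<alpha>. \<alpha>(v := d - k')) ` F k'"
        then have "\<alpha> v = d - k" "\<alpha> v = d - k'" by (auto dest: fun_cong [of _ _ v])
        with \<open>k \<in> {..d}\<close> \<open>k' \<in> {..d}\<close> \<open>k \<noteq> k'\<close> show False by simp
      qed
    qed (use IH in auto)
    also have "\<dots> = (\<Sum>k\<le>d. (card V + k) choose card V)"
    proof (rule sum.cong [OF refl])
      fix k
      have "inj_on (\<lambda>\<alpha>. \<alpha>(v := d - k)) (F k)"
        using insert.hyps(2)
        by (intro inj_on_inverseI [where g = "\<lambda>\<beta>. \<beta>(v := 0)"]) (auto simp: F_def)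
      then show "card ((\<lambda>\<alpha>. \<alpha>(v := d - k)) ` F k) = (card V + k) choose card V"
        using IH by (simp add: card_image add.commute)
    qed
    also have "\<dots> = (d + card (insert v V)) choose card (insert v V)"
      using insert.hyps by (simp only: choose_rising_sum(1)) (simp add: add.commute)
    finally show ?case unfolding eq using IH by auto
  qed
  from this [of UNIV]
  show "finite {\<alpha> :: 'n \<Rightarrow> nat. weight \<alpha> \<le> d}"
    and "card {\<alpha> :: 'n \<Rightarrow> nat. weight \<alpha> \<le> d} = (d + CARD('n)) choose CARD('n)"
    by simp_all
qed

text \<open>Vanishing to order \<open>m\<close> on \<open>K\<close> is a homogeneous linear system
  with one equation for each point of \<open>K\<close> and each index of weight below
  \<open>m\<close>. By assumption there are fewer equations than unknown coefficients.\<close>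

lemma exists_vanishing_polynomial:
  fixes K :: "('n::finite \<Rightarrow> 'a::{field,finite}) set"
  assumes "card K * card {i :: 'n \<Rightarrow> nat. weight i < m} < card {\<alpha> :: 'n \<Rightarrow> nat. weight \<alpha> \<le> d}"
  obtains E and c :: "('n \<Rightarrow> nat) \<Rightarrow> 'a"
  where "finite E" "E \<noteq> {}" "\<And>\<alpha>. \<alpha> \<in> E \<Longrightarrow> c \<alpha> \<noteq> 0" "\<And>\<alpha>. \<alpha> \<in> E \<Longrightarrow> weight \<alpha> \<le> d"
    "\<And>a i. a \<in> K \<Longrightarrow> weight i < m \<Longrightarrow> taylor_coeff E c a i = 0"
proof -
  define D where "D = {\<alpha> :: 'n \<Rightarrow> nat. weight \<alpha> \<le> d}"
  define I where "I = {i :: 'n \<Rightarrow> nat. weight i < m}"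
  have "finite D" by (simp add: D_def finite_weight_le)
  have "finite I"
    by (rule finite_subset [of _ "{i. weight i \<le> m}"]) (auto simp: I_def finite_weight_le)
  define C where "C = (D \<rightarrow>\<^sub>E (UNIV :: 'a set))"
  define \<Phi> where "\<Phi> = (\<lambda>c. \<lambda>(a, i)\<in>K \<times> I. taylor_coeff D c a i)"
  \<comment> \<open>Over a finite field, pigeonhole on coefficient vectors replaces the dimension count.\<close>
  have "CARD('a) \<ge> 2"
    using card_mono [of UNIV "{0, 1 :: 'a}"] by simp
  then have "CARD('a) ^ (card K * card I) < CARD('a) ^ card D"
    using assms by (intro power_strict_increasing) (auto simp: I_def D_def)
  moreover have "card C = CARD('a) ^ card D"
    using \<open>finite D\<close> by (simp add: C_def card_PiE)
  moreover have "finite (K \<times> I \<rightarrow>\<^sub>E (UNIV :: 'a set))"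
    "card (K \<times> I \<rightarrow>\<^sub>E (UNIV :: 'a set)) = CARD('a) ^ (card K * card I)"
    using \<open>finite I\<close> by (auto simp: card_PiE card_cartesian_product intro!: finite_PiE)
  moreover have "\<Phi> ` C \<subseteq> (K \<times> I \<rightarrow>\<^sub>E (UNIV :: 'a set))"
    by (auto simp: \<Phi>_def split: if_splits)
  ultimately have "\<not> inj_on \<Phi> C"
    using card_inj_on_le [of \<Phi> C] by (metis leD)
  then obtain c1 c2 where c12: "c1 \<in> C" "c2 \<in> C" "\<Phi> c1 = \<Phi> c2" "c1 \<noteq> c2"
    by (auto simp: inj_on_def)
  \<comment> \<open>By linearity the difference of two colliding vectors solves the system. Passing
    to its support \<open>E\<close> makes all remaining coefficients nonzero.\<close>
  define c where "c = (\<lambda>\<alpha>. c1 \<alpha> - c2 \<alpha>)"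
  define E where "E = {\<alpha>\<in>D. c \<alpha> \<noteq> 0}"
  show ?thesis
  proof
    show "finite E" using \<open>finite D\<close> by (simp add: E_def)
    show "E \<noteq> {}"
    proof
      assume "E = {}"
      then have "c1 = c2" using c12 by (intro PiE_ext [of c1 D _ c2]) (auto simp: C_def E_def c_def)
      with c12 show False by simp
    qed
    show "c \<alpha> \<noteq> 0" "weight \<alpha> \<le> d" if "\<alpha> \<in> E" for \<alpha>
      using that by (auto simp: E_def D_def)
    show "taylor_coeff E c a i = 0" if "a \<in> K" "weight i < m" for a i
    proof -
      have "taylor_coeff E c a i = taylor_coeff D c a i"
        unfolding taylor_coeff_def using \<open>finite D\<close> by (intro sum.mono_neutral_left) (auto simp: E_def)
      also have "\<dots> = taylor_coeff D c1 a i - taylor_coeff D c2 a i"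
        by (simp add: taylor_coeff_def c_def left_diff_distrib sum_subtractf)
      also have "\<dots> = 0"
        using fun_cong [OF c12(3), of "(a, i)"] that by (simp add: \<Phi>_def I_def)
      finally show ?thesis .
    qed
  qed
qed

section \<open>Carrying vanishing from \<open>K\<close> to \<open>S\<close> along the curves\<close>

text \<open>Otherwise interpolation gives a nonzero polynomial of degree at most \<open>d\<close>
  vanishing to order \<open>m\<close> on \<open>K\<close>. Hypothesis \<open>m\<close> gives its
  derivatives of weight below \<open>L\<close> too many zeros along each curve, and hypothesis
  \<open>d\<close> contradicts the resulting order \<open>L\<close> on \<open>S\<close>.\<close>

lemma curves_multiplicity_bound:
  fixes S K :: "('n::finite \<Rightarrow> 'a::{field,finite}) set"
  assumes curves: "\<And>x. x \<in> S \<Longrightarrow> \<exists>A. (\<forall>j. degree (A j) \<le> N) \<and> (\<exists>t. (\<lambda>j. poly (A j) t) = x) \<and>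
      r \<le> real (card {t. (\<lambda>j. poly (A j) t) \<in> K})"
    and m: "\<And>w. w < L \<Longrightarrow> w \<le> d \<Longrightarrow> real N * real (d - w) < real (m - w) * r"
    and d: "d * CARD('a) ^ CARD('n) < CARD('a) * (L * card S)"
  shows "card {\<alpha> :: 'n \<Rightarrow> nat. weight \<alpha> \<le> d} \<le> card K * card {i :: 'n \<Rightarrow> nat. weight i < m}"
proof (rule ccontr)
  assume "\<not> ?thesis"
  then have "card K * card {i :: 'n \<Rightarrow> nat. weight i < m} < card {\<alpha> :: 'n \<Rightarrow> nat. weight \<alpha> \<le> d}"
    by simp
  then obtain E and c :: "('n \<Rightarrow> nat) \<Rightarrow> 'a"
    where E: "finite E" "E \<noteq> {}" "\<And>\<alpha>. \<alpha> \<in> E \<Longrightarrow> c \<alpha> \<noteq> 0" "\<And>\<alpha>. \<alpha> \<in> E \<Longrightarrow> weight \<alpha> \<le> d"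
      and van: "\<And>a i. a \<in> K \<Longrightarrow> weight i < m \<Longrightarrow> taylor_coeff E c a i = 0"
    by (rule exists_vanishing_polynomial) (rule that; blast)
  have "taylor_coeff E c x i = 0" if x: "x \<in> S" and i: "weight i < L" for x i
  proof (cases "weight i \<le> d")
    \<comment> \<open>Derivatives of weight above the degree vanish anyway, so hypothesis
      \<open>m\<close> is only required for \<open>w \<le> d\<close>.\<close>
    case False
    show ?thesis
    proof (rule taylor_coeff_eq_0)
      fix \<alpha> assume "\<alpha> \<in> E"
      then have "weight \<alpha> < weight i" using E(4) False by (meson le_less_trans not_le)
      then show "\<exists>j. \<alpha> j < i j" by (intro weight_le_imp_exists_less) auto
    qed
  next
    case True
    obtain A t\<^sub>0 where A: "\<And>j. degree (A j) \<le> N" "(\<lambda>j. poly (A j) t\<^sub>0) = x"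
      "r \<le> real (card {t. (\<lambda>j. poly (A j) t) \<in> K})"
      using curves [OF x] by blast
    define T where "T = {t. (\<lambda>j. poly (A j) t) \<in> K}"
    define R where "R = taylor_coeff E (\<lambda>\<alpha>. [:c \<alpha>:]) A i"
    have "R = 0"
    proof (rule ccontr)
      assume "R \<noteq> 0"
      have "[:- t, 1:] ^ (m - weight i) dvd R" if "t \<in> T" for t
        unfolding R_def using that E(1) van by (intro taylor_coeff_multiplicity) (auto simp: T_def)
      then have "(\<Sum>t\<in>T. m - weight i) \<le> degree R"
        using \<open>R \<noteq> 0\<close> by (intro sum_multiplicities_le_degree) auto
      also have "\<dots> \<le> N * (d - weight i)"
        unfolding R_def using E(1,4) A(1) by (rule degree_taylor_coeff_le)
      finally have "(m - weight i) * card T \<le> N * (d - weight i)"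
        by (simp add: mult.commute)
      then have "real (m - weight i) * real (card T) \<le> real N * real (d - weight i)"
        by (metis of_nat_le_iff of_nat_mult)
      moreover have "real (m - weight i) * r \<le> real (m - weight i) * real (card T)"
        using A(3) by (intro mult_left_mono) (simp_all add: T_def)
      ultimately show False using m [OF i True] by linarith
    qed
    then have "poly R t\<^sub>0 = 0" by simp
    then show ?thesis by (simp add: R_def poly_taylor_coeff A(2))
  qed
  \<comment> \<open>The order function only has to be a lower bound: \<open>L\<close> on
    \<open>S\<close> and \<open>0\<close> elsewhere.\<close>
  then have "CARD('a) * (\<Sum>x\<in>UNIV. if x \<in> S then L else 0) \<le> d * CARD('a) ^ CARD('n)"
    by (intro schwartz_zippel_multiplicity [OF E]) (auto split: if_splits)
  moreover have "(\<Sum>x\<in>UNIV. if x \<in> S then L else 0) = L * card S"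
    by (simp add: sum.If_cases)
  ultimately show False using d by simp
qed

section \<open>Power bounds for the binomial counts\<close>

text \<open>The right side is the product of \<open>d + 1\<close> up to
  \<open>d + n\<close>.\<close>

lemma power_le_binomial_fact: "d ^ n \<le> ((d + n) choose n) * fact n"
proof (induction n)
  case (Suc n)
  have "d ^ Suc n \<le> (d + Suc n) * (((d + n) choose n) * fact n)"
    using mult_le_mono [of d "d + Suc n", OF _ Suc] by simp
  also have "\<dots> = Suc n * ((d + Suc n) choose Suc n) * fact n"
    using Suc_times_binomial [of n "d + n"] by (simp only: add_Suc_right mult.assoc)
  also have "\<dots> = ((d + Suc n) choose Suc n) * fact (Suc n)"
    by (simp only: fact_Suc of_nat_id mult_ac)
  finally show ?case .
qed simp

text \<open>Both counts are compared with powers divided by the same factorial, which cancels. The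
  shift from \<open>m\<close> to \<open>m + CARD('n)\<close> disappears in the limit.\<close>

lemma power_le_of_card_weight_le:
  assumes "card {\<alpha> :: 'n::finite \<Rightarrow> nat. weight \<alpha> \<le> d} \<le> k * card {i :: 'n \<Rightarrow> nat. weight i < m}"
  shows "d ^ CARD('n) \<le> k * (m + CARD('n)) ^ CARD('n)"
proof -
  let ?n = "CARD('n)"
  have "card {i :: 'n \<Rightarrow> nat. weight i < m} \<le> card {i :: 'n \<Rightarrow> nat. weight i \<le> m}"
    by (intro card_mono) (auto simp: finite_weight_le)
  then have "card {i :: 'n \<Rightarrow> nat. weight i < m} \<le> (m + ?n) choose ?n"
    by (simp add: card_weight_le)
  then have "(d + ?n) choose ?n \<le> k * ((m + ?n) choose ?n)"
    using assms by (simp add: card_weight_le) (meson le_trans mult_le_mono2)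
  then have "((d + ?n) choose ?n) * fact ?n \<le> k * (((m + ?n) choose ?n) * fact ?n)"
    by (metis mult.assoc mult_le_mono1)
  also have "\<dots> \<le> k * (m + ?n) ^ ?n"
    by (intro mult_le_mono2 binomial_fact_pow)
  finally show ?thesis using power_le_binomial_fact [of d ?n] by linarith
qed

section \<open>Choice of parameters and passage to the limit\<close>

theorem theorem13:
  fixes S K :: "('a::{field,finite} ^ 'n::finite) set"
    and q n \<Lambda> :: nat
    and l \<eta> :: real
  assumes q: "q = CARD('a)"
    and n: "n = CARD('n)"
    and l: "l > 0"
    and eta: "\<eta> > 0"
    and Lambda: "\<Lambda> > 0"
    and eta_q: "\<eta> * real q > real \<Lambda>"
    and S: "real (card S) = l * real q ^ n"
    and K: "\<forall>x\<in>S. \<exists>C. curve_degree C \<le> \<Lambda> \<and> passes_through C x \<and>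
              real (card {t. curve_eval C t \<in> K}) \<ge> \<eta> * real q"
  shows "real (card K) \<ge>
           (l * real q / (real \<Lambda> * ((l * real q - 1) / (\<eta> * real q)) + 1)) ^ n
       \<and> (l \<ge> \<eta> \<longrightarrow> real (card K) \<ge> (\<eta> * real q / (real \<Lambda> + 1)) ^ n)"
proof -
  define S' where "S' = vec_nth ` S"
  define K' where "K' = vec_nth ` K"
  have card_vec: "card (vec_nth ` X) = card X" for X :: "('a ^ 'n) set"
    by (intro card_image inj_onI) (simp add: vec_nth_inject)
  have curves: "\<exists>A. (\<forall>j. degree (A j) \<le> \<Lambda>) \<and> (\<exists>t. (\<lambda>j. poly (A j) t) = x) \<and>
      \<eta> * real q \<le> real (card {t. (\<lambda>j. poly (A j) t) \<in> K'})" if x: "x \<in> S'" for x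
  proof -
    from x obtain y where y: "y \<in> S" "x = vec_nth y" by (auto simp: S'_def)
    with K obtain C t\<^sub>0 where C: "curve_degree C \<le> \<Lambda>" "curve_eval C t\<^sub>0 = y"
      "\<eta> * real q \<le> real (card {t. curve_eval C t \<in> K})"
      by (auto simp: passes_through_def)
    have ev: "(\<lambda>j. poly (C $ j) t) = vec_nth (curve_eval C t)" for t
      by (simp add: curve_eval_def fun_eq_iff)
    have "degree (C $ j) \<le> \<Lambda>" for j
      using C(1) Max_ge [of "range (\<lambda>i. degree (C $ i))" "degree (C $ j)"]
      by (simp add: curve_degree_def)
    moreover have "vec_nth z \<in> K' \<longleftrightarrow> z \<in> K" for z
      by (auto simp: K'_def vec_nth_inject)
    ultimately show ?thesis
      using C(2,3) y(2) by (intro exI [of _ "vec_nth C"]) (auto simp: ev)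
  qed
  have "q > 0" by (simp add: q)
  define \<rho> where "\<rho> = real \<Lambda> / (\<eta> * real q)"
  have r: "\<eta> * real q > 0" using eta \<open>q > 0\<close> by simp
  have \<rho>: "0 < \<rho>" "\<rho> < 1" using r eta_q Lambda by (simp_all add: \<rho>_def)
  define D where "D = \<rho> * (l * real q - 1) + 1"
  have "l * real q > 0" using l \<open>q > 0\<close> by simp
  \<comment> \<open>This form shows that \<open>D\<close> is positive even when
    \<open>l * real q < 1\<close>.\<close>
  have "D = \<rho> * (l * real q) + (1 - \<rho>)" by (simp add: D_def algebra_simps)
  then have "D > 0" using \<rho> \<open>l * real q > 0\<close> by (simp add: add_pos_pos)
  have bound: "((l * real q * real L - 1) / (D * real L + (2 + real n))) ^ n \<le> real (card K)"
    if L: "L \<ge> 1" "l * real q * real L \<ge> 1" for L :: nat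
  proof -
    \<comment> \<open>\<open>d\<close> is the largest degree contradicting Schwartz--Zippel with multiplicity \<open>L\<close> on \<open>S\<close>, and \<open>m\<close> is
      the least order on \<open>K\<close> that forces multiplicity \<open>L\<close> on \<open>S\<close>; the worst case is weight \<open>L - 1\<close>.\<close>
    define d where "d = nat (\<lceil>l * real q * real L\<rceil> - 1)"
    have d: "l * real q * real L - 1 \<le> real d" "real d < l * real q * real L"
      using L(2) unfolding d_def by linarith+
    define g where "g = \<rho> * (real d - (real L - 1)) + (real L - 1)"
    define m where "m = nat (\<lfloor>g\<rfloor> + 1)"
    have "g = \<rho> * real d + (1 - \<rho>) * (real L - 1)" by (simp add: g_def algebra_simps)
    then have "g \<ge> 0" using \<rho> L(1) by simp
    then have m: "g < real m" "real m \<le> g + 1" unfolding m_def by linarith+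
    have "real \<Lambda> * real (d - w) < real (m - w) * (\<eta> * real q)" if w: "w < L" "w \<le> d" for w
    proof -
      \<comment> \<open>Since \<open>\<rho> < 1\<close>, the left side increases with
        \<open>w\<close>; at \<open>w = L - 1\<close> it equals \<open>g\<close>.\<close>
      have "\<rho> * (real d - real w) + real w \<le> g"
      proof -
        have "(1 - \<rho>) * real w \<le> (1 - \<rho>) * (real L - 1)"
          using w(1) \<rho>(2) by (intro mult_left_mono) auto
        then show ?thesis by (simp add: g_def algebra_simps)
      qed
      then have "\<rho> * real (d - w) < real m - real w" using m(1) w(2) by (simp add: of_nat_diff)
      also have "\<dots> \<le> real (m - w)" by linarith
      finally show ?thesis using r by (simp add: \<rho>_def divide_less_eq)
    qed
    moreover have "d * CARD('a) ^ CARD('n) < CARD('a) * (L * card S')"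
    proof -
      have "real d * real q ^ n < l * real q * real L * real q ^ n"
        using d(2) \<open>q > 0\<close> by (intro mult_strict_right_mono) auto
      also have "\<dots> = real q * (real L * real (card S'))"
        by (simp add: S'_def card_vec S)
      finally have "real (d * q ^ n) < real (q * (L * card S'))" by simp
      then show ?thesis unfolding of_nat_less_iff by (simp add: q n)
    qed
    ultimately have "card {\<alpha> :: 'n \<Rightarrow> nat. weight \<alpha> \<le> d} \<le> card K' * card {i :: 'n \<Rightarrow> nat. weight i < m}"
      using curves by (rule curves_multiplicity_bound [rotated])
    then have "d ^ n \<le> card K * (m + n) ^ n"
      unfolding n K'_def card_vec by (rule power_le_of_card_weight_le)
    then have "real d ^ n \<le> real (card K) * (real m + real n) ^ n"
      by (metis of_nat_add of_nat_le_iff of_nat_mult of_nat_power)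
    moreover have "real m + real n > 0" using m(1) \<open>g \<ge> 0\<close> by linarith
    ultimately have dm: "(real d / (real m + real n)) ^ n \<le> real (card K)"
      by (simp add: power_divide divide_le_eq)
    \<comment> \<open>Replacing \<open>d\<close> by its upper bound makes the slope in
      \<open>L\<close> exactly \<open>D\<close>; rounding and dimension go into the constant
      \<open>2 + real n\<close>.\<close>
    have "g \<le> \<rho> * (l * real q * real L - (real L - 1)) + (real L - 1)"
      unfolding g_def using d(2) \<rho>(1) by (intro add_right_mono mult_left_mono) auto
    also have "\<dots> = D * real L + \<rho> - 1" by (simp add: D_def algebra_simps)
    finally have "real m + real n \<le> D * real L + (2 + real n)" using m(2) \<rho>(2) by linarith
    then have "(l * real q * real L - 1) / (D * real L + (2 + real n)) \<le> real d / (real m + real n)"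
      using d(1) L(2) \<open>real m + real n > 0\<close> by (intro frac_le) auto
    \<comment> \<open>Taking powers is monotone only on nonnegative bases, hence the restriction to
      \<open>l * real q * real L \<ge> 1\<close>.\<close>
    moreover have "0 \<le> (l * real q * real L - 1) / (D * real L + (2 + real n))"
      using L(2) \<open>D > 0\<close> by (intro divide_nonneg_nonneg) auto
    ultimately have "((l * real q * real L - 1) / (D * real L + (2 + real n))) ^ n \<le>
        (real d / (real m + real n)) ^ n"
      by (intro power_mono)
    with dm show ?thesis by linarith
  qed
  have "((\<lambda>L. (l * real q * real L - 1) / (D * real L + (2 + real n))) \<longlongrightarrow> l * real q / D) sequentially"
  proof -
    have "((\<lambda>L. (l * real q * real L - 1) / (D * real L + (2 + real n))) \<longlongrightarrow> l * real q * inverse D) sequentially"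
      using \<open>D > 0\<close> \<open>l * real q > 0\<close> by real_asymp
    then show ?thesis by (simp only: divide_inverse)
  qed
  then have lim: "((\<lambda>L. ((l * real q * real L - 1) / (D * real L + (2 + real n))) ^ n)
      \<longlongrightarrow> (l * real q / D) ^ n) sequentially"
    by (rule tendsto_power)
  have "eventually (\<lambda>L. l * real q * real L \<ge> 1) sequentially"
    using \<open>l * real q > 0\<close> by real_asymp
  then have "eventually (\<lambda>L. ((l * real q * real L - 1) / (D * real L + (2 + real n))) ^ n \<le> real (card K))
      sequentially"
    using eventually_ge_at_top [of 1] by eventually_elim (rule bound)
  then have main: "(l * real q / D) ^ n \<le> real (card K)"
    by (intro tendsto_upperbound [OF lim]) auto
  have D_eq: "D = real \<Lambda> * ((l * real q - 1) / (\<eta> * real q)) + 1"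
    by (simp add: D_def \<rho>_def)
  have "(\<eta> * real q / (real \<Lambda> + 1)) ^ n \<le> real (card K)" if "l \<ge> \<eta>"
  proof -
    have "\<eta> * real q * D = real \<Lambda> * (l * real q - 1) + \<eta> * real q"
    proof -
      have "\<eta> * real q * \<rho> = real \<Lambda>" using eta \<open>q > 0\<close> by (simp add: \<rho>_def)
      then show ?thesis by (simp only: D_def distrib_left mult.assoc [symmetric] mult_1_right)
    qed
    \<comment> \<open>After the common term \<open>l * real q * real \<Lambda>\<close> is cancelled,
      this follows from \<open>\<eta> * real q \<le> l * real q\<close>.\<close>
    also have "\<dots> \<le> l * real q * (real \<Lambda> + 1)"
      using mult_right_mono [OF that, of "real q"] by (simp add: algebra_simps)
    finally have "\<eta> * real q / (real \<Lambda> + 1) \<le> l * real q / D"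
      using \<open>D > 0\<close> by (simp add: field_simps)
    then have "(\<eta> * real q / (real \<Lambda> + 1)) ^ n \<le> (l * real q / D) ^ n"
      using r by (intro power_mono) auto
    with main show ?thesis by linarith
  qed
  with main show ?thesis unfolding D_eq by blast
qed

end
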